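(* Let $X$ be a finite set with $n$ elements, $n\geq 1$, and let $S$ be a semilattice in $T(X)$. Suppose that $S\neq E_s$ for every $s\in X$. Then $|S|<2^{n-1}$.
   Context: $T(X)$ denotes the semigroup of all functions from $X$ to $X$ under composition. Functions are written on the right and composed from left to right: $x(fg)=(xf)g$. A semilattice is a commutative semigroup consisting entirely of idempotents; a "semilattice in $T(X)$" means a subsemigroup of $T(X)$ that is a semilattice. For $t\in X$ let $X_t=X-\{t\}$. For $A\subseteq X_t$ (possibly empty), let $e_A\in T(X)$ be the transformation with $xe_A=x$ if $x\in A$ and $xe_A=t$ if $x\in X-A$. Define $E_t=\{e_A : A\subseteq X_t\}\subseteq T(X)$. *)

theory Defs
  imports Main "HOL-Library.FuncSet"
begin

text \<open>
  Functions on \<^term>\<open>X\<close> are represented by extensional functions, so that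
  HOL equality is equality on \<^term>\<open>X\<close> and cardinalities of sets of
  transformations are the intended ones.
\<close>

definition full_transf :: "'a set \<Rightarrow> ('a \<Rightarrow> 'a) set" where
  "full_transf X = (X \<rightarrow>\<^sub>E X)"

text \<open>Left-to-right composition, \<open>x(fg) = (xf)g\<close>; note the argument order of
  \<^const>\<open>compose\<close>.\<close>

definition tcomp :: "'a set \<Rightarrow> ('a \<Rightarrow> 'a) \<Rightarrow> ('a \<Rightarrow> 'a) \<Rightarrow> ('a \<Rightarrow> 'a)" where
  "tcomp X f g = compose X g f"

text \<open>The empty set is admitted as a subsemigroup.\<close>

definition subsemigroup_of_transf :: "'a set \<Rightarrow> ('a \<Rightarrow> 'a) set \<Rightarrow> bool" where
  "subsemigroup_of_transf X S \<longleftrightarrow>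
     S \<subseteq> full_transf X \<and> (\<forall>f\<in>S. \<forall>g\<in>S. tcomp X f g \<in> S)"

definition semilattice_in_transf :: "'a set \<Rightarrow> ('a \<Rightarrow> 'a) set \<Rightarrow> bool" where
  "semilattice_in_transf X S \<longleftrightarrow>
     subsemigroup_of_transf X S \<and>
     (\<forall>f\<in>S. \<forall>g\<in>S. tcomp X f g = tcomp X g f) \<and>
     (\<forall>f\<in>S. tcomp X f f = f)"

definition e_transf :: "'a set \<Rightarrow> 'a \<Rightarrow> 'a set \<Rightarrow> ('a \<Rightarrow> 'a)" where
  "e_transf X t A = (\<lambda>x\<in>X. if x \<in> A then x else t)"

definition E_transf :: "'a set \<Rightarrow> 'a \<Rightarrow> ('a \<Rightarrow> 'a) set" where
  "E_transf X t = {e_transf X t A | A. A \<subseteq> X - {t}}"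

lemma tcomp_closed:
  "f \<in> full_transf X \<Longrightarrow> g \<in> full_transf X \<Longrightarrow> tcomp X f g \<in> full_transf X"
  unfolding full_transf_def tcomp_def by (auto simp: compose_def)

lemma tcomp_assoc:
  "f \<in> full_transf X \<Longrightarrow> tcomp X (tcomp X f g) h = tcomp X f (tcomp X g h)"
  unfolding full_transf_def tcomp_def by (auto simp: compose_def PiE_mem fun_eq_iff)

end

theory Submission
  imports Defs
begin

text \<open>
  An idempotent is determined by its image, which is its set of fixed points, together with its
  kernel. Among commuting idempotents the image alone suffices
  (\<open>semilattice_eq_if_fixed_points_eq\<close>). As a nonempty finite semilattice \<open>S\<close> has a least element,
  whose image lies in every other image, there is a point \<open>t\<close> fixed by all of \<open>S\<close>
  (\<open>semilattice_common_fixed_point\<close>). So \<open>e \<mapsto> im e - {t}\<close> embeds \<open>S\<close> into the power set of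
  \<open>X - {t}\<close>, and \<open>S\<close> has at most \<open>2 ^ (n - 1)\<close> elements.

  If this bound is attained, every subset of \<open>X\<close> that contains \<open>t\<close> is an image; in particular so is
  \<open>{t, b}\<close> for every \<open>b\<close>. An element of \<open>S\<close> with image \<open>{t, b}\<close> forces every other element
  to fix \<open>b\<close> or to send it to \<open>t\<close> (\<open>semilattice_moves_to_common_fixed_point\<close>). So an element of \<open>S\<close>
  with image \<open>A \<union> {t}\<close> is \<open>e\<^sub>A\<close>, and since every such image occurs, \<open>S = E\<^sub>t\<close>
  (\<open>semilattice_eq_E_transf\<close>), which is excluded.
\<close>

definition fixed_points :: "'a set \<Rightarrow> ('a \<Rightarrow> 'a) \<Rightarrow> 'a set" where
  "fixed_points X f = {x \<in> X. f x = x}"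

lemma semilattice_maps_into:
  assumes "semilattice_in_transf X S" "f \<in> S" "x \<in> X"
  shows "f x \<in> X"
  using assms
  unfolding semilattice_in_transf_def subsemigroup_of_transf_def full_transf_def
  by (auto dest: PiE_mem)

lemma semilattice_commute:
  assumes "semilattice_in_transf X S" "f \<in> S" "g \<in> S" "x \<in> X"
  shows "f (g x) = g (f x)"
proof -
  have "tcomp X f g = tcomp X g f"
    using assms unfolding semilattice_in_transf_def by blast
  then have "tcomp X f g x = tcomp X g f x" by simp
  then show ?thesis using \<open>x \<in> X\<close> by (simp add: tcomp_def compose_def)
qed

lemma semilattice_idem:
  assumes "semilattice_in_transf X S" "f \<in> S" "x \<in> X"
  shows "f (f x) = f x"
proof -
  have "tcomp X f f = f"
    using assms unfolding semilattice_in_transf_def by blast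
  then have "tcomp X f f x = f x" by simp
  then show ?thesis using \<open>x \<in> X\<close> by (simp add: tcomp_def compose_def)
qed

text \<open>
  The value \<open>f x\<close> is a fixed point of \<open>f\<close>, hence of \<open>g\<close>, so \<open>g (f x) = f x\<close>; by symmetry
  \<open>f (g x) = g x\<close>, and commutation equates the two.
\<close>

lemma semilattice_eq_if_fixed_points_eq:
  assumes S: "semilattice_in_transf X S" "f \<in> S" "g \<in> S"
    and eq: "fixed_points X f = fixed_points X g"
  shows "f = g"
proof (rule extensionalityI[of _ X])
  show "f \<in> extensional X" "g \<in> extensional X"
    using S
    unfolding semilattice_in_transf_def subsemigroup_of_transf_def full_transf_def
    by (auto simp: PiE_def)
  fix x assume x: "x \<in> X"
  have "f x \<in> fixed_points X f" "g x \<in> fixed_points X g"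
    using S x by (auto simp: fixed_points_def semilattice_maps_into semilattice_idem)
  then have "g (f x) = f x" "f (g x) = g x"
    using eq by (auto simp: fixed_points_def)
  then show "f x = g x"
    using semilattice_commute[OF S x] by simp
qed

lemma fixed_points_tcomp_subset:
  assumes S: "semilattice_in_transf X S" "f \<in> S" "g \<in> S"
  shows "fixed_points X (tcomp X f g) \<subseteq> fixed_points X f \<inter> fixed_points X g"
proof
  fix x assume "x \<in> fixed_points X (tcomp X f g)"
  then have x: "x \<in> X" and gf: "g (f x) = x"
    by (auto simp: fixed_points_def tcomp_def compose_def)
  have fg: "f (g x) = x"
    using semilattice_commute[OF S x] gf by simp
  have "g x = x"
    using semilattice_idem[OF S(1,3) semilattice_maps_into[OF S(1,2) x]] gf by simp
  moreover have "f x = x"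
    using semilattice_idem[OF S(1,2) semilattice_maps_into[OF S(1,3) x]] fg by simp
  ultimately show "x \<in> fixed_points X f \<inter> fixed_points X g"
    using x by (simp add: fixed_points_def)
qed

text \<open>
  An element \<open>z\<close> with the fewest fixed points plays the part of the least element: multiplying it by
  \<open>f\<close> cannot lose any of them, so \<open>f\<close> fixes every point of the image of \<open>z\<close>, which is not empty.
\<close>

lemma semilattice_common_fixed_point:
  assumes S: "semilattice_in_transf X S" "S \<noteq> {}" and X: "finite X" "X \<noteq> {}"
  obtains t where "t \<in> X" "\<And>f. f \<in> S \<Longrightarrow> f t = t"
proof -
  obtain z where z: "z \<in> S"
    and least: "\<And>f. f \<in> S \<Longrightarrow> card (fixed_points X z) \<le> card (fixed_points X f)"
    using ex_has_least_nat[of "\<lambda>f. f \<in> S" _ "\<lambda>f. card (fixed_points X f)"] S(2) by blast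
  obtain p where p: "p \<in> X" using X by blast
  have zp: "z p \<in> fixed_points X z"
    using S(1) z p by (simp add: fixed_points_def semilattice_maps_into semilattice_idem)
  have "f (z p) = z p" if f: "f \<in> S" for f
  proof -
    have "tcomp X z f \<in> S"
      using S(1) z f unfolding semilattice_in_transf_def subsemigroup_of_transf_def by blast
    then have "card (fixed_points X z) \<le> card (fixed_points X (tcomp X z f))"
      by (rule least)
    moreover have "fixed_points X (tcomp X z f) \<subseteq> fixed_points X z"
      using fixed_points_tcomp_subset[OF S(1) z f] by blast
    moreover have "finite (fixed_points X z)"
      using X(1) by (simp add: fixed_points_def)
    ultimately have "fixed_points X (tcomp X z f) = fixed_points X z"
      by (intro card_seteq)
    then show ?thesis
      using zp fixed_points_tcomp_subset[OF S(1) z f] by (auto simp: fixed_points_def)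
  qed
  moreover have "z p \<in> X"
    using zp by (simp add: fixed_points_def)
  ultimately show thesis by (rule that[rotated])
qed

text \<open>
  Since \<open>h\<close> fixes \<open>b\<close>, commutation shows that \<open>h\<close> fixes \<open>f b\<close> too; so \<open>f b\<close> is \<open>t\<close> or \<open>b\<close>.
\<close>

lemma semilattice_moves_to_common_fixed_point:
  assumes S: "semilattice_in_transf X S" "f \<in> S" "h \<in> S"
    and b: "b \<in> X" "f b \<noteq> b" and h: "fixed_points X h = {t, b}"
  shows "f b = t"
proof -
  have "h b = b" using h by (auto simp: fixed_points_def)
  then have "h (f b) = f b"
    using semilattice_commute[OF S b(1)] by simp
  then have "f b \<in> fixed_points X h"
    using semilattice_maps_into[OF S(1,2) b(1)] by (simp add: fixed_points_def)
  then show ?thesis using h b by blast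
qed

text \<open>
  The surjectivity hypothesis is used twice: on singletons, so that every moved point is sent to \<open>t\<close>
  and \<open>S \<subseteq> E\<^sub>t\<close>, and on an arbitrary \<open>A\<close>, to find \<open>e\<^sub>A\<close> in \<open>S\<close>.
\<close>

lemma semilattice_eq_E_transf:
  assumes S: "semilattice_in_transf X S"
    and t: "t \<in> X" "\<And>f. f \<in> S \<Longrightarrow> f t = t"
    and all: "(\<lambda>f. fixed_points X f - {t}) ` S = Pow (X - {t})"
  shows "S = E_transf X t"
proof
  have form: "f = e_transf X t (fixed_points X f - {t})" if f: "f \<in> S" for f
  proof
    fix x
    show "f x = e_transf X t (fixed_points X f - {t}) x"
    proof (cases "x \<in> X \<and> f x \<noteq> x")
      case True
      then have "x \<noteq> t" using t f by blast
      then have "{x} \<in> (\<lambda>f. fixed_points X f - {t}) ` S"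
        using all True by simp
      then obtain h where h: "h \<in> S" "fixed_points X h - {t} = {x}" by auto
      have "t \<in> fixed_points X h"
        using t h by (simp add: fixed_points_def)
      with h have "fixed_points X h = {t, x}" by blast
      then have "f x = t"
        using semilattice_moves_to_common_fixed_point[OF S f h(1)] True by blast
      then show ?thesis using True by (simp add: e_transf_def fixed_points_def)
    next
      case False
      have "f \<in> extensional X"
        using S f
        unfolding semilattice_in_transf_def subsemigroup_of_transf_def full_transf_def
        by (auto simp: PiE_def)
      then show ?thesis
        using False by (auto simp: e_transf_def fixed_points_def extensional_def)
    qed
  qed
  have sub: "fixed_points X f - {t} \<subseteq> X - {t}" for f
    by (auto simp: fixed_points_def)
  show "S \<subseteq> E_transf X t"
    unfolding E_transf_def using form sub by blast
  show "E_transf X t \<subseteq> S"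
  proof
    fix e assume "e \<in> E_transf X t"
    then obtain A where A: "A \<subseteq> X - {t}" "e = e_transf X t A"
      unfolding E_transf_def by blast
    then have "A \<in> (\<lambda>f. fixed_points X f - {t}) ` S"
      using all by blast
    then obtain f where "f \<in> S" "fixed_points X f - {t} = A" by blast
    then show "e \<in> S" using form A by metis
  qed
qed

theorem theorem5p2:
  fixes X :: "'a set" and n :: nat and S :: "('a \<Rightarrow> 'a) set"
  assumes "finite X" and "card X = n" and "n \<ge> 1"
    and "semilattice_in_transf X S"
    and "\<And>s. s \<in> X \<Longrightarrow> S \<noteq> E_transf X s"
  shows "card S < 2 ^ (n - 1)"
proof (cases "S = {}")
  case True
  then show ?thesis by simp
next
  case False
  have "X \<noteq> {}" using assms(2,3) by auto
  then obtain t where t: "t \<in> X" "\<And>f. f \<in> S \<Longrightarrow> f t = t"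
    using semilattice_common_fixed_point[OF assms(4) False assms(1)] by blast
  let ?\<phi> = "\<lambda>f. fixed_points X f - {t}"
  have inj: "inj_on ?\<phi> S"
  proof (rule inj_onI)
    fix f g assume fg: "f \<in> S" "g \<in> S" "?\<phi> f = ?\<phi> g"
    then have "t \<in> fixed_points X f" "t \<in> fixed_points X g"
      using t by (auto simp: fixed_points_def)
    then have "fixed_points X f = fixed_points X g" using fg by blast
    then show "f = g"
      using semilattice_eq_if_fixed_points_eq[OF assms(4)] fg by blast
  qed
  have "?\<phi> ` S \<subseteq> Pow (X - {t})"
    by (auto simp: fixed_points_def)
  moreover have "?\<phi> ` S \<noteq> Pow (X - {t})"
  proof
    assume "?\<phi> ` S = Pow (X - {t})"
    then have "S = E_transf X t"
      by (intro semilattice_eq_E_transf assms(4) t)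
    then show False using assms(5)[OF t(1)] by simp
  qed
  ultimately have "card (?\<phi> ` S) < card (Pow (X - {t}))"
    using assms(1) by (intro psubset_card_mono) auto
  then show ?thesis
    using assms(1,2) t(1) by (simp add: card_image[OF inj] card_Pow)
qed

end
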